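(* Let $p,q\ge1$ be integers and let $\Gamma=\mathbb{Z}_p\times\mathbb{Z}_q\subset SU(3)$ be the group of matrices $\mathrm{diag}(\omega_1,\omega_2^{-1},\omega_1^{-1}\omega_2)$ with $\omega_1^p=1$, $\omega_2^q=1$. Then a spectral measure over $\mathbb{T}^2$ of the McKay graph $\mathcal{G}_\Gamma$ is the product measure $$\mathrm{d}\varepsilon(\omega_1,\omega_2)=\mathrm{d}_{p/2}\omega_1\;\mathrm{d}_{q/2}\omega_2 .$$
   Context: For a finite subgroup $\Gamma\subset SU(3)$ let $\rho$ be the 3-dimensional representation given by the inclusion. The McKay graph $\mathcal{G}_\Gamma$ has as vertices the irreducible representations of $\Gamma$ (up to isomorphism), with adjacency matrix $\Delta_{\sigma,\sigma'}$ = multiplicity of $\sigma'$ in $\rho\otimes\sigma$; $\Delta$ is normal. Let $e_1$ be the basis vector of the trivial representation. With $\mathbb{T}$ the unit circle and $R_{m,n}(\omega_1,\omega_2)=(\omega_1+\omega_2^{-1}+\omega_1^{-1}\omega_2)^m(\omega_1^{-1}+\omega_2+\omega_1\omega_2^{-1})^{n}$, a measure $\varepsilon$ on $\mathbb{T}^2$ is called a spectral measure over $\mathbb{T}^2$ of $\mathcal{G}_\Gamma$ (or of $\Gamma$) if $\int_{\mathbb{T}^2}R_{m,n}\,\mathrm{d}\varepsilon=\langle\Delta^m(\Delta^\ast)^n e_1,e_1\rangle$ for all integers $m,n\ge0$. For $2k\in\mathbb{N}$, $\mathrm{d}_k$ denotes the uniform probability measure on the $2k$-th roots of unity. *)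

theory Defs
  imports
    "HOL-Probability.Probability"
    "Jordan_Normal_Form.Schur_Decomposition"
    "Jordan_Normal_Form.VS_Connect"
begin

definition GL :: "nat \<Rightarrow> complex mat monoid" where
  "GL n = units_of (ring_mat TYPE(complex) n ())"

definition rep :: "('g, 'm) monoid_scheme \<Rightarrow> nat \<Rightarrow> ('g \<Rightarrow> complex mat) \<Rightarrow> bool" where
  "rep G n \<sigma> \<longleftrightarrow> \<sigma> \<in> hom G (GL n)"

definition irreducible_rep :: "('g, 'm) monoid_scheme \<Rightarrow> nat \<Rightarrow> ('g \<Rightarrow> complex mat) \<Rightarrow> bool" where
  "irreducible_rep G n \<sigma> \<longleftrightarrow> rep G n \<sigma> \<and> n > 0 \<and>
     (\<forall>W. VectorSpace.subspace class_ring W (module_vec TYPE(complex) n) \<longrightarrow>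
          (\<forall>g\<in>carrier G. \<forall>w\<in>W. \<sigma> g *\<^sub>v w \<in> W) \<longrightarrow>
          W = {0\<^sub>v n} \<or> W = carrier_vec n)"

definition irreps :: "('g, 'm) monoid_scheme \<Rightarrow> ('g \<Rightarrow> complex mat) set" where
  "irreps G = {\<sigma>. \<exists>n. irreducible_rep G n \<sigma>}"

text \<open>Only the values on \<^term>\<open>carrier G\<close> matter, so two functions that agree there
  are isomorphic.\<close>
definition rep_iso :: "('g, 'm) monoid_scheme \<Rightarrow> ('g \<Rightarrow> complex mat) \<Rightarrow> ('g \<Rightarrow> complex mat) \<Rightarrow> bool" where
  "rep_iso G \<sigma> \<tau> \<longleftrightarrow> (\<exists>n. rep G n \<sigma> \<and> rep G n \<tau> \<and>
     (\<exists>P Q. \<forall>g\<in>carrier G. similar_mat_wit (\<sigma> g) (\<tau> g) P Q))"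

definition trivial_rep :: "'g \<Rightarrow> complex mat" where
  "trivial_rep = (\<lambda>g. 1\<^sub>m 1)"

definition rep_sum :: "('g \<Rightarrow> complex mat) list \<Rightarrow> 'g \<Rightarrow> complex mat" where
  "rep_sum \<sigma>s = (\<lambda>g. diag_block_mat (map (\<lambda>\<sigma>. \<sigma> g) \<sigma>s))"

definition kronecker :: "complex mat \<Rightarrow> complex mat \<Rightarrow> complex mat" where
  "kronecker A B = Matrix.mat (dim_row A * dim_row B) (dim_col A * dim_col B)
     (\<lambda>(i, j). A $$ (i div dim_row B, j div dim_col B) * B $$ (i mod dim_row B, j mod dim_col B))"

definition rep_tensor :: "('g \<Rightarrow> complex mat) \<Rightarrow> ('g \<Rightarrow> complex mat) \<Rightarrow> 'g \<Rightarrow> complex mat" where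
  "rep_tensor \<sigma> \<tau> = (\<lambda>g. kronecker (\<sigma> g) (\<tau> g))"

text \<open>The number of summands isomorphic to \<open>\<sigma>'\<close> in a decomposition of \<open>\<tau>\<close> into irreducibles;
  for a finite group such a decomposition exists and the number does not depend on it.\<close>
definition multiplicity_in :: "('g, 'm) monoid_scheme \<Rightarrow> ('g \<Rightarrow> complex mat) \<Rightarrow> ('g \<Rightarrow> complex mat) \<Rightarrow> nat" where
  "multiplicity_in G \<sigma>' \<tau> =
     (THE k. \<exists>\<sigma>s. set \<sigma>s \<subseteq> irreps G \<and> rep_iso G \<tau> (rep_sum \<sigma>s) \<and>
                  k = length (filter (rep_iso G \<sigma>') \<sigma>s))"

definition SU :: "nat \<Rightarrow> complex mat monoid" where
  "SU n = \<lparr>carrier = {A \<in> carrier_mat n n. A * mat_adjoint A = 1\<^sub>m n \<and> Determinant.det A = 1},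
           mult = (*), one = 1\<^sub>m n\<rparr>"

text \<open>A vertex is an isomorphism class of irreducible representations.\<close>
type_synonym vertex = "(complex mat \<Rightarrow> complex mat) set"

definition group_of :: "complex mat set \<Rightarrow> complex mat monoid" where
  "group_of \<Gamma> = (SU 3)\<lparr>carrier := \<Gamma>\<rparr>"

definition mckay_vertices :: "complex mat set \<Rightarrow> vertex set" where
  "mckay_vertices \<Gamma> = irreps (group_of \<Gamma>) //
     {(\<sigma>, \<tau>). \<sigma> \<in> irreps (group_of \<Gamma>) \<and> \<tau> \<in> irreps (group_of \<Gamma>) \<and> rep_iso (group_of \<Gamma>) \<sigma> \<tau>}"

text \<open>The inclusion representation \<open>\<rho>\<close> is \<open>\<lambda>g. g\<close>. The multiplicity depends only on the
  isomorphism classes, so the choice of representatives is immaterial.\<close>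
definition mckay_adjacency :: "complex mat set \<Rightarrow> vertex \<Rightarrow> vertex \<Rightarrow> complex" where
  "mckay_adjacency \<Gamma> X Y =
     of_nat (multiplicity_in (group_of \<Gamma>) (SOME \<sigma>'. \<sigma>' \<in> Y) (rep_tensor (\<lambda>g. g) (SOME \<sigma>. \<sigma> \<in> X)))"

definition trivial_vector :: "vertex \<Rightarrow> complex" where
  "trivial_vector X = (if trivial_rep \<in> X then 1 else 0)"

definition apply_matrix :: "'v set \<Rightarrow> ('v \<Rightarrow> 'v \<Rightarrow> complex) \<Rightarrow> ('v \<Rightarrow> complex) \<Rightarrow> 'v \<Rightarrow> complex" where
  "apply_matrix V A x = (\<lambda>i. \<Sum>j\<in>V. A i j * x j)"

definition adjoint_matrix :: "('v \<Rightarrow> 'v \<Rightarrow> complex) \<Rightarrow> 'v \<Rightarrow> 'v \<Rightarrow> complex" where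
  "adjoint_matrix A = (\<lambda>i j. cnj (A j i))"

definition inner_on :: "'v set \<Rightarrow> ('v \<Rightarrow> complex) \<Rightarrow> ('v \<Rightarrow> complex) \<Rightarrow> complex" where
  "inner_on V x y = (\<Sum>i\<in>V. x i * cnj (y i))"

definition mckay_moment :: "complex mat set \<Rightarrow> nat \<Rightarrow> nat \<Rightarrow> complex" where
  "mckay_moment \<Gamma> m n =
     (let V = mckay_vertices \<Gamma>; \<Delta> = mckay_adjacency \<Gamma>; e = trivial_vector
      in inner_on V ((apply_matrix V \<Delta> ^^ m) ((apply_matrix V (adjoint_matrix \<Delta>) ^^ n) e)) e)"

abbreviation circle :: "complex set" where
  "circle \<equiv> sphere 0 1"

definition R_poly :: "nat \<Rightarrow> nat \<Rightarrow> complex \<times> complex \<Rightarrow> complex" where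
  "R_poly m n = (\<lambda>(\<omega>1, \<omega>2).
     (\<omega>1 + inverse \<omega>2 + inverse \<omega>1 * \<omega>2) ^ m * (inverse \<omega>1 + \<omega>2 + \<omega>1 * inverse \<omega>2) ^ n)"

definition spectral_measure :: "complex mat set \<Rightarrow> (complex \<times> complex) measure \<Rightarrow> bool" where
  "spectral_measure \<Gamma> \<epsilon> \<longleftrightarrow>
     finite \<Gamma> \<and> subgroup \<Gamma> (SU 3) \<and>
     sets \<epsilon> = sets (restrict_space borel (circle \<times> circle)) \<and>
     (\<forall>m n. integrable \<epsilon> (R_poly m n) \<and> (\<integral>\<omega>. R_poly m n \<omega> \<partial>\<epsilon>) = mckay_moment \<Gamma> m n)"

text \<open>The uniform probability measure on the \<open>2k\<close>-th roots of unity, as a Borel measure on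
  the circle, for \<open>k\<close> a positive integer or half-integer.\<close>
definition root_measure :: "real \<Rightarrow> complex measure" where
  "root_measure k =
     distr (uniform_count_measure {z. z ^ nat \<lfloor>2 * k\<rfloor> = 1}) (restrict_space borel circle) (\<lambda>z. z)"

definition Zpq :: "nat \<Rightarrow> nat \<Rightarrow> complex mat set" where
  "Zpq p q = {mat_diag 3 (\<lambda>i. [\<omega>1, inverse \<omega>2, inverse \<omega>1 * \<omega>2] ! i) | \<omega>1 \<omega>2. \<omega>1 ^ p = 1 \<and> \<omega>2 ^ q = 1}"

end

theory Submission
  imports Defs "Jordan_Normal_Form.Spectral_Radius" "HOL-Algebra.Multiplicative_Group"
begin

text \<open>
  Irreducible representations of a finite abelian group are characters, so for a finite group
  \<open>\<Gamma>\<close> of diagonal matrices the vertices of the McKay graph are the characters of \<open>\<Gamma>\<close>, and by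
  orthogonality \<open>\<Delta>\<close> has the entries \<open>(1/|\<Gamma>|) \<Sum>\<^sub>g tr g \<cdot> \<eta>(g) \<cdot> cnj (\<theta>(g))\<close>. The diagonal entries
  are themselves characters and separate the points of \<open>\<Gamma>\<close>, which gives column orthogonality without
  a classification of the characters. Hence the vectors \<open>\<eta> \<mapsto> \<eta>(g)\<close> are an eigenbasis of
  \<open>\<Delta>\<close> with eigenvalues \<open>tr g\<close>, and \<open>e\<^sub>1\<close> is their average. The moments are therefore the averages of
  \<open>(tr g)\<^sup>m (cnj (tr g))\<^sup>n\<close> over \<open>\<Gamma>\<close>, which for \<open>\<int>\<^sub>p \<times> \<int>\<^sub>q\<close> are the integrals of \<open>R\<^sub>m\<^sub>,\<^sub>n\<close>
  against the product of the two root measures.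
\<close>

section \<open>Characters of finite groups\<close>

text \<open>Extensionality makes two characters that agree on the group equal as functions, so that
  they can be counted and summed over. The value 1 at the identity excludes the zero map.\<close>

definition characters :: "('g, 'm) monoid_scheme \<Rightarrow> ('g \<Rightarrow> complex) set" where
  "characters G = {\<eta> \<in> extensional (carrier G). \<eta> \<one>\<^bsub>G\<^esub> = 1 \<and>
     (\<forall>x\<in>carrier G. \<forall>y\<in>carrier G. \<eta> (x \<otimes>\<^bsub>G\<^esub> y) = \<eta> x * \<eta> y)}"

lemma characters_one: "\<eta> \<in> characters G \<Longrightarrow> \<eta> \<one>\<^bsub>G\<^esub> = 1"
  and characters_mult: "\<eta> \<in> characters G \<Longrightarrow> x \<in> carrier G \<Longrightarrow> y \<in> carrier G \<Longrightarrow>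
    \<eta> (x \<otimes>\<^bsub>G\<^esub> y) = \<eta> x * \<eta> y"
  and characters_extensional: "\<eta> \<in> characters G \<Longrightarrow> \<eta> \<in> extensional (carrier G)"
  by (auto simp: characters_def)

lemma (in group) characters_times:
  assumes "\<eta> \<in> characters G" "\<psi> \<in> characters G"
  shows "restrict (\<lambda>x. \<eta> x * \<psi> x) (carrier G) \<in> characters G"
  using assms by (auto simp: characters_def)

section \<open>Orthogonality relations for characters\<close>

locale finite_group = group G for G (structure) +
  assumes finite_carrier: "finite (carrier G)"
begin

text \<open>Source of both the absolute value 1 and the finiteness of the set of characters: all
  values are roots of unity of one fixed order.\<close>

lemma character_power_order:
  assumes "\<eta> \<in> characters G" "x \<in> carrier G"
  shows "\<eta> x ^ order G = 1"
proof -
  have "\<eta> (x [^] n) = \<eta> x ^ n" for n :: nat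
    using assms by (induction n) (auto simp: characters_one characters_mult)
  then show ?thesis
    using assms pow_order_eq_1[of x] by (metis characters_one)
qed

lemma order_pos: "order G > 0"
  using finite_carrier one_closed by (auto simp: order_def card_gt_0_iff)

lemma character_norm:
  assumes "\<eta> \<in> characters G" "x \<in> carrier G"
  shows "cmod (\<eta> x) = 1"
  using character_power_order[OF assms] order_pos
  by (metis norm_one norm_power norm_ge_zero power_eq_1_iff power_0 less_irrefl)

lemma character_mult_cnj:
  assumes "\<eta> \<in> characters G" "x \<in> carrier G"
  shows "\<eta> x * cnj (\<eta> x) = 1"
  using character_norm[OF assms] by (simp add: complex_norm_square[symmetric])

lemma character_inv:
  assumes "\<eta> \<in> characters G" "x \<in> carrier G"
  shows "\<eta> (inv x) = cnj (\<eta> x)"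
proof -
  have "\<eta> x * \<eta> (inv x) = 1"
    using assms by (metis characters_mult characters_one inv_closed r_inv)
  then show ?thesis
    using character_mult_cnj[OF assms] by (metis mult_cancel_left mult_zero_left zero_neq_one)
qed

lemma finite_characters: "finite (characters G)"
proof (rule finite_subset)
  show "characters G \<subseteq> carrier G \<rightarrow>\<^sub>E {z. z ^ order G = 1}"
    using character_power_order by (auto simp: PiE_def characters_extensional)
  show "finite (carrier G \<rightarrow>\<^sub>E {z::complex. z ^ order G = 1})"
    using finite_carrier order_pos by (intro finite_PiE finite_roots_unity) auto
qed

text \<open>Translating the summation variable by \<open>y\<close> multiplies the sum by
  \<open>\<eta> y * cnj (\<psi> y)\<close>. Choosing \<open>y\<close> where the two characters
  differ makes this factor different from 1, so the sum vanishes.\<close>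

lemma characters_row_orthogonal:
  assumes \<eta>: "\<eta> \<in> characters G" and \<psi>: "\<psi> \<in> characters G"
  shows "(\<Sum>x\<in>carrier G. \<eta> x * cnj (\<psi> x)) = (if \<eta> = \<psi> then of_nat (order G) else 0)"
proof (cases "\<eta> = \<psi>")
  case True
  then show ?thesis
    using character_mult_cnj[OF \<psi>] by (simp add: order_def)
next
  case False
  define S where "S = (\<Sum>x\<in>carrier G. \<eta> x * cnj (\<psi> x))"
  obtain y where y: "y \<in> carrier G" "\<eta> y \<noteq> \<psi> y"
    using False \<eta> \<psi> by (metis characters_extensional extensionalityI)
  have "S = (\<Sum>x\<in>carrier G. \<eta> (y \<otimes> x) * cnj (\<psi> (y \<otimes> x)))"
    unfolding S_def using y(1)
    by (intro sum.reindex_bij_witness[of _ "\<lambda>x. y \<otimes> x" "\<lambda>x. inv y \<otimes> x"])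
       (auto simp: m_assoc[symmetric])
  also have "\<dots> = \<eta> y * cnj (\<psi> y) * S"
    using \<eta> \<psi> y(1) by (auto simp: S_def sum_distrib_left characters_mult intro!: sum.cong)
  finally have "S = 0 \<or> \<eta> y * cnj (\<psi> y) = 1"
    by (metis mult_cancel_right1 mult.commute)
  \<comment> \<open>\<open>cnj (\<psi> y)\<close> is the inverse of \<open>\<psi> y\<close>, so the
    product is 1 only if the values agree.\<close>
  moreover have "\<eta> y * cnj (\<psi> y) \<noteq> 1"
    using character_mult_cnj[OF \<psi> y(1)] y(2)
    by (metis mult_cancel_right mult_zero_right zero_neq_one)
  ultimately show ?thesis
    using False by (simp add: S_def)
qed

text \<open>Dual form of the translation argument: multiplication by \<open>\<eta>\<close> permutes
  the characters and scales the sum by \<open>\<eta> x\<close>.\<close>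

lemma sum_characters_eq_0:
  assumes \<eta>: "\<eta> \<in> characters G" and x: "x \<in> carrier G" and ne: "\<eta> x \<noteq> 1"
  shows "(\<Sum>\<psi>\<in>characters G. \<psi> x) = 0"
proof -
  define S where "S = (\<Sum>\<psi>\<in>characters G. \<psi> x)"
  \<comment> \<open>The conjugate character is the inverse of \<open>\<eta>\<close> and provides the
    inverse of the permutation.\<close>
  have mem_cnj: "restrict (\<lambda>x. cnj (\<eta> x)) (carrier G) \<in> characters G"
    using \<eta> by (auto simp: characters_def)
  have "S = (\<Sum>\<psi>\<in>characters G. restrict (\<lambda>x. \<eta> x * \<psi> x) (carrier G) x)"
    unfolding S_def
  proof (rule sum.reindex_bij_witness[of _ "\<lambda>\<psi>. restrict (\<lambda>x. \<eta> x * \<psi> x) (carrier G)"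
        "\<lambda>\<psi>. restrict (\<lambda>x. restrict (\<lambda>x. cnj (\<eta> x)) (carrier G) x * \<psi> x) (carrier G)"])
    fix \<psi> assume \<psi>: "\<psi> \<in> characters G"
    show *: "restrict (\<lambda>x. \<eta> x * restrict (\<lambda>x. restrict (\<lambda>x. cnj (\<eta> x)) (carrier G) x * \<psi> x) (carrier G) x)
        (carrier G) = \<psi>"
      using \<psi> character_mult_cnj[OF \<eta>]
      by (intro extensionalityI[of _ "carrier G"])
         (auto simp: mult.assoc[symmetric] characters_extensional)
    show "restrict (\<lambda>x. restrict (\<lambda>x. cnj (\<eta> x)) (carrier G) x *
        restrict (\<lambda>x. \<eta> x * \<psi> x) (carrier G) x) (carrier G) = \<psi>"
      using \<psi> character_mult_cnj[OF \<eta>]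
      by (intro extensionalityI[of _ "carrier G"])
         (auto simp: mult.assoc[symmetric] mult.commute[of "cnj _"] characters_extensional)
    show "restrict (\<lambda>x. \<eta> x * \<psi> x) (carrier G) \<in> characters G"
      by (rule characters_times[OF \<eta> \<psi>])
    show "restrict (\<lambda>x. restrict (\<lambda>x. cnj (\<eta> x)) (carrier G) x * \<psi> x) (carrier G) \<in> characters G"
      by (rule characters_times[OF mem_cnj \<psi>])
    show "restrict (\<lambda>x. \<eta> x *
        restrict (\<lambda>x. restrict (\<lambda>x. cnj (\<eta> x)) (carrier G) x * \<psi> x) (carrier G) x) (carrier G) x = \<psi> x"
      unfolding * ..
  qed
  also have "\<dots> = \<eta> x * S"
    using x by (simp add: S_def sum_distrib_left)
  finally show ?thesis
    using ne by (simp add: S_def)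
qed

text \<open>Summing \<open>\<eta> x\<close> over all pairs in both orders shows that there are as
  many characters as group elements: one order leaves only the trivial character, by row
  orthogonality, and the other leaves only the identity, by separation of points.\<close>

lemma sum_characters:
  assumes sep: "\<And>x. x \<in> carrier G \<Longrightarrow> x \<noteq> \<one> \<Longrightarrow> \<exists>\<eta>\<in>characters G. \<eta> x \<noteq> 1"
    and x: "x \<in> carrier G"
  shows "(\<Sum>\<eta>\<in>characters G. \<eta> x) = (if x = \<one> then of_nat (order G) else 0)"
proof -
  define triv :: "'a \<Rightarrow> complex" where "triv = restrict (\<lambda>_. 1) (carrier G)"
  have triv: "triv \<in> characters G"
    by (auto simp: triv_def characters_def)
  have "(\<Sum>x\<in>carrier G. \<eta> x) = (if \<eta> = triv then of_nat (order G) else 0)"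
    if "\<eta> \<in> characters G" for \<eta>
    using characters_row_orthogonal[OF that triv] by (simp add: triv_def)
  then have "of_nat (order G) = (\<Sum>\<eta>\<in>characters G. \<Sum>x\<in>carrier G. \<eta> x)"
    using triv finite_characters by simp
  also have "\<dots> = (\<Sum>x\<in>carrier G. \<Sum>\<eta>\<in>characters G. \<eta> x)"
    by (rule sum.swap)
  also have "\<dots> = (\<Sum>x\<in>carrier G. if x = \<one> then of_nat (card (characters G)) else 0)"
    using sep sum_characters_eq_0
    by (intro sum.cong) (auto simp: characters_one)
  also have "\<dots> = of_nat (card (characters G))"
    using finite_carrier by simp
  finally have "card (characters G) = order G"
    by simp
  then show ?thesis
    using sep[OF x] sum_characters_eq_0[OF _ x] by (auto simp: characters_one)
qed

text \<open>\<open>cnj (\<eta> x) * \<eta> y\<close> is the value of \<open>\<eta>\<close> at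
  \<open>inv x \<otimes> y\<close>, which reduces the claim to
  \<open>sum_characters\<close>.\<close>

lemma characters_column_orthogonal:
  assumes sep: "\<And>x. x \<in> carrier G \<Longrightarrow> x \<noteq> \<one> \<Longrightarrow> \<exists>\<eta>\<in>characters G. \<eta> x \<noteq> 1"
    and x: "x \<in> carrier G" and y: "y \<in> carrier G"
  shows "(\<Sum>\<eta>\<in>characters G. cnj (\<eta> x) * \<eta> y) = (if x = y then of_nat (order G) else 0)"
proof -
  have "(\<Sum>\<eta>\<in>characters G. cnj (\<eta> x) * \<eta> y) = (\<Sum>\<eta>\<in>characters G. \<eta> (inv x \<otimes> y))"
    using x y by (intro sum.cong) (auto simp: characters_mult character_inv)
  moreover have "inv x \<otimes> y = \<one> \<longleftrightarrow> x = y"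
    using x y by (metis inv_equality inv_inv inv_closed l_inv)
  ultimately show ?thesis
    using sum_characters[OF sep, of "inv x \<otimes> y"] x y by simp
qed

end

section \<open>Representations of abelian groups\<close>

definition mat_trace :: "'a :: comm_monoid_add mat \<Rightarrow> 'a" where
  "mat_trace A = (\<Sum>i<dim_row A. A $$ (i, i))"

lemma mat_trace_mult_commute:
  fixes A B :: "'a :: comm_semiring_0 mat"
  assumes "A \<in> carrier_mat n m" "B \<in> carrier_mat m n"
  shows "mat_trace (A * B) = mat_trace (B * A)"
proof -
  have "mat_trace (A * B) = (\<Sum>i<n. \<Sum>j<m. A $$ (i, j) * B $$ (j, i))"
    using assms by (auto simp: mat_trace_def scalar_prod_def lessThan_atLeast0 intro!: sum.cong)
  also have "\<dots> = (\<Sum>j<m. \<Sum>i<n. B $$ (j, i) * A $$ (i, j))"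
    by (subst sum.swap) (simp add: mult.commute)
  also have "\<dots> = mat_trace (B * A)"
    using assms by (auto simp: mat_trace_def scalar_prod_def lessThan_atLeast0 intro!: sum.cong)
  finally show ?thesis .
qed

lemma mat_trace_similar:
  fixes A B :: "'a :: comm_semiring_1 mat"
  assumes "similar_mat_wit A B P Q"
  shows "mat_trace A = mat_trace B"
proof -
  define n where "n = dim_row A"
  have carr: "P \<in> carrier_mat n n" "B \<in> carrier_mat n n" "Q \<in> carrier_mat n n"
    and inverse: "Q * P = 1\<^sub>m n" and A: "A = P * B * Q"
    using assms unfolding similar_mat_wit_def Let_def n_def by blast+
  have "mat_trace A = mat_trace (Q * (P * B))"
    unfolding A using carr by (intro mat_trace_mult_commute[of _ n n] mult_carrier_mat)
  also have "Q * (P * B) = 1\<^sub>m n * B"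
    using carr by (simp only: assoc_mult_mat[symmetric, of Q n n P n B n] inverse)
  also have "\<dots> = B"
    using carr by simp
  finally show ?thesis .
qed

lemma mat_trace_1: "A \<in> carrier_mat 1 1 \<Longrightarrow> mat_trace A = A $$ (0, 0)"
  by (auto simp: mat_trace_def)

lemma index_mult_mat_1:
  fixes A B :: "'a :: semiring_0 mat"
  assumes "A \<in> carrier_mat 1 1" "B \<in> carrier_mat 1 1"
  shows "(A * B) $$ (0, 0) = A $$ (0, 0) * B $$ (0, 0)"
  using assms by (auto simp: scalar_prod_def)

lemma mat_trace_diag_block_mat:
  assumes "\<And>A. A \<in> set As \<Longrightarrow> dim_row A = dim_col A"
  shows "mat_trace (diag_block_mat As) = (\<Sum>A\<leftarrow>As. mat_trace A)"
  using assms
proof (induction As)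
  case Nil
  then show ?case by (simp add: mat_trace_def)
next
  case (Cons A As)
  have split: "(\<Sum>i<a + b. f i) = (\<Sum>i<a. f i) + (\<Sum>i<b. f (a + i))" for a b and f :: "nat \<Rightarrow> 'a"
    by (induction b) (auto simp: add_ac)
  have "square_mat (diag_block_mat As)"
    using Cons.prems by (intro diag_block_mat_square) auto
  then show ?case
    using Cons.IH Cons.prems[of A] Cons.prems
    by (auto simp: Let_def mat_trace_def split intro!: arg_cong2[of _ _ _ _ "(+)"] sum.cong)
qed

section \<open>Matrix representations of a group\<close>

lemma rep_carrier: "rep G n \<sigma> \<Longrightarrow> g \<in> carrier G \<Longrightarrow> \<sigma> g \<in> carrier_mat n n"
  by (auto simp: rep_def GL_def hom_def units_of_def Units_def ring_mat_simps)

lemma rep_mult: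
  "rep G n \<sigma> \<Longrightarrow> g \<in> carrier G \<Longrightarrow> h \<in> carrier G \<Longrightarrow> \<sigma> (g \<otimes>\<^bsub>G\<^esub> h) = \<sigma> g * \<sigma> h"
  by (auto simp: rep_def GL_def hom_def units_of_def ring_mat_simps)

lemma group_GL: "group (GL n)"
proof -
  interpret ring "ring_mat TYPE(complex) n ()" by (rule ring_mat)
  show ?thesis unfolding GL_def by (rule units_group)
qed

lemma rep_one:
  assumes "group G" "rep G n \<sigma>"
  shows "\<sigma> \<one>\<^bsub>G\<^esub> = 1\<^sub>m n"
proof -
  interpret group_hom G "GL n" \<sigma>
    using assms group_GL by (auto simp: group_hom_def group_hom_axioms_def rep_def)
  show ?thesis
    using hom_one by (simp add: GL_def units_of_one ring_mat_simps)
qed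

text \<open>Membership in \<open>GL n\<close> comes from the group: the image of the inverse of
  \<open>g\<close> is a two-sided inverse of \<open>\<sigma> g\<close>.\<close>

lemma repI:
  assumes "group G" and carr: "\<And>g. g \<in> carrier G \<Longrightarrow> \<sigma> g \<in> carrier_mat n n"
    and one: "\<sigma> \<one>\<^bsub>G\<^esub> = 1\<^sub>m n"
    and mult: "\<And>g h. g \<in> carrier G \<Longrightarrow> h \<in> carrier G \<Longrightarrow> \<sigma> (g \<otimes>\<^bsub>G\<^esub> h) = \<sigma> g * \<sigma> h"
  shows "rep G n \<sigma>"
proof -
  interpret group G by fact
  have "\<sigma> g \<in> Units (ring_mat TYPE(complex) n ())" if g: "g \<in> carrier G" for g
  proof -
    have "\<sigma> g * \<sigma> (inv\<^bsub>G\<^esub> g) = 1\<^sub>m n" "\<sigma> (inv\<^bsub>G\<^esub> g) * \<sigma> g = 1\<^sub>m n"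
      using g by (simp_all add: mult[symmetric] one)
    then show ?thesis
      using carr[OF g] carr[of "inv\<^bsub>G\<^esub> g"] g by (auto simp: Units_def ring_mat_simps)
  qed
  then show ?thesis
    by (auto simp: rep_def GL_def hom_def units_of_def ring_mat_simps mult)
qed

section \<open>Invariant subspaces and Schur's lemma for abelian groups\<close>

lemma subspace_carrier_vecI:
  assumes "W \<subseteq> carrier_vec n" "0\<^sub>v n \<in> W" "\<And>v w. v \<in> W \<Longrightarrow> w \<in> W \<Longrightarrow> v + w \<in> W"
    "\<And>c v. v \<in> W \<Longrightarrow> c \<cdot>\<^sub>v v \<in> W"
  shows "VectorSpace.subspace class_ring W (module_vec TYPE('a :: field) n)"
  using assms vec_vs vec_module
  by (auto simp: VectorSpace.subspace_def LinearCombinations.submodule_def module_vec_simps)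

lemma subspace_smult_closed:
  assumes "VectorSpace.subspace class_ring W (module_vec TYPE('a :: field) n)" "w \<in> W"
  shows "c \<cdot>\<^sub>v w \<in> W"
  using assms
  by (auto simp: VectorSpace.subspace_def LinearCombinations.submodule_def module_vec_simps)

lemma subspace_carrier_vecD:
  assumes "VectorSpace.subspace class_ring W (module_vec TYPE('a :: field) n)"
  shows "W \<subseteq> carrier_vec n" "0\<^sub>v n \<in> W"
  using assms
  by (auto simp: VectorSpace.subspace_def LinearCombinations.submodule_def module_vec_simps)

text \<open>Schur's argument: over the complex numbers \<open>\<sigma> g\<close> has an eigenvalue
  \<open>k\<close>. Its eigenspace is invariant because all \<open>\<sigma> h\<close> commute with
  \<open>\<sigma> g\<close>, and being nonzero it is the whole space.\<close>

lemma (in comm_group) irreducible_rep_scalar: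
  assumes irr: "irreducible_rep G n \<sigma>" and g: "g \<in> carrier G"
  obtains k where "\<And>w. w \<in> carrier_vec n \<Longrightarrow> \<sigma> g *\<^sub>v w = k \<cdot>\<^sub>v w"
proof -
  have rep: "rep G n \<sigma>" and n: "n > 0"
    using irr by (auto simp: irreducible_rep_def)
  note A = rep_carrier[OF rep]
  obtain k v where v: "eigenvector (\<sigma> g) v k"
    using spectrum_non_empty[OF A[OF g] n] by (auto simp: spectrum_def eigenvalue_def)
  define W where "W = {w \<in> carrier_vec n. \<sigma> g *\<^sub>v w = k \<cdot>\<^sub>v w}"
  have "\<sigma> h *\<^sub>v w \<in> W" if "h \<in> carrier G" "w \<in> W" for h w
  proof -
    have w: "w \<in> carrier_vec n" "\<sigma> g *\<^sub>v w = k \<cdot>\<^sub>v w"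
      using that by (auto simp: W_def)
    have "\<sigma> g *\<^sub>v (\<sigma> h *\<^sub>v w) = (\<sigma> g * \<sigma> h) *\<^sub>v w"
      by (rule assoc_mult_mat_vec[symmetric, OF A[OF g] A[OF that(1)] w(1)])
    also have "\<sigma> g * \<sigma> h = \<sigma> h * \<sigma> g"
      using rep_mult[OF rep] m_comm g that(1) by metis
    also have "(\<sigma> h * \<sigma> g) *\<^sub>v w = \<sigma> h *\<^sub>v (k \<cdot>\<^sub>v w)"
      unfolding w(2)[symmetric] by (rule assoc_mult_mat_vec[OF A[OF that(1)] A[OF g] w(1)])
    also have "\<dots> = k \<cdot>\<^sub>v (\<sigma> h *\<^sub>v w)"
      by (rule mult_mat_vec[OF A[OF that(1)] w(1)])
    finally show ?thesis
      using mult_mat_vec_carrier[OF A[OF that(1)] w(1)] by (simp add: W_def)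
  qed
  moreover have "VectorSpace.subspace class_ring W (module_vec TYPE(complex) n)"
    using A[OF g]
    by (intro subspace_carrier_vecI)
       (auto simp: W_def mult_mat_vec[of _ n n] mult_add_distrib_mat_vec[of _ n n] smult_add_distrib_vec
          smult_smult_assoc mult.commute)
  ultimately have "W = {0\<^sub>v n} \<or> W = carrier_vec n"
    using irr by (auto simp: irreducible_rep_def)
  moreover have "v \<in> W" "v \<noteq> 0\<^sub>v n"
    using v A[OF g] by (auto simp: eigenvector_def W_def)
  ultimately have "W = carrier_vec n" by auto
  then show ?thesis
    by (intro that[of k]) (auto simp: W_def)
qed

text \<open>Since every group element acts by a scalar, every line is invariant. The line through
  the first unit vector can exhaust the space only in dimension one.\<close>

lemma (in comm_group) irreducible_rep_dim:
  assumes irr: "irreducible_rep G n \<sigma>"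
  shows "n = 1"
proof (rule ccontr)
  assume "n \<noteq> 1"
  then have n: "n > 1"
    using irr by (auto simp: irreducible_rep_def)
  define W where "W = range (\<lambda>c :: complex. c \<cdot>\<^sub>v unit_vec n 0)"
  have "\<sigma> g *\<^sub>v w \<in> W" if g: "g \<in> carrier G" and w: "w \<in> W" for g w
  proof -
    obtain k where "\<And>w. w \<in> carrier_vec n \<Longrightarrow> \<sigma> g *\<^sub>v w = k \<cdot>\<^sub>v w"
      using irreducible_rep_scalar[OF irr g] by blast
    then show ?thesis
      using w by (auto simp: W_def smult_smult_assoc)
  qed
  moreover have "VectorSpace.subspace class_ring W (module_vec TYPE(complex) n)"
  proof (rule subspace_carrier_vecI)
    have "0\<^sub>v n = (0 :: complex) \<cdot>\<^sub>v unit_vec n 0"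
      by auto
    then show "0\<^sub>v n \<in> W"
      unfolding W_def by blast
  qed (auto simp: W_def smult_smult_assoc add_smult_distrib_vec[symmetric])
  ultimately have "W = {0\<^sub>v n} \<or> W = carrier_vec n"
    using irr by (auto simp: irreducible_rep_def)
  moreover have "unit_vec n 0 \<in> W"
    unfolding W_def by (rule range_eqI[of _ _ 1]) simp
  moreover have "unit_vec n 0 \<noteq> (0\<^sub>v n :: complex vec)"
    using n by (intro unit_vec_nonzero) auto
  \<comment> \<open>The line is nonzero, hence everything, so it would contain the second unit
    vector as well. Comparing the entries at index 1 gives the contradiction.\<close>
  ultimately have "unit_vec n 1 \<in> W" by auto
  then obtain c :: complex where "unit_vec n 1 = c \<cdot>\<^sub>v unit_vec n 0"
    by (auto simp: W_def)
  then have "unit_vec n 1 $ 1 = (c \<cdot>\<^sub>v unit_vec n 0) $ 1"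
    by simp
  then show False
    using n by simp
qed

lemma irreducible_rep_1:
  assumes "rep G 1 \<sigma>"
  shows "irreducible_rep G 1 \<sigma>"
  unfolding irreducible_rep_def
proof (intro conjI allI impI)
  fix W assume W: "VectorSpace.subspace class_ring W (module_vec TYPE(complex) 1)"
  show "W = {0\<^sub>v 1} \<or> W = carrier_vec 1"
  proof (rule disjCI)
    assume "W \<noteq> carrier_vec 1"
    show "W = {0\<^sub>v 1}"
    proof (rule ccontr)
      assume "W \<noteq> {0\<^sub>v 1}"
      then obtain w where w: "w \<in> W" "w \<noteq> 0\<^sub>v 1"
        using subspace_carrier_vecD[OF W] by auto
      then have "w $ 0 \<noteq> 0"
        using subspace_carrier_vecD[OF W] by (auto simp: vec_eq_iff)
      then have "v = (v $ 0 / w $ 0) \<cdot>\<^sub>v w" if "v \<in> carrier_vec 1" for v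
        using that w subspace_carrier_vecD[OF W] by (auto simp: vec_eq_iff)
      then have "carrier_vec 1 \<subseteq> W"
        using subspace_smult_closed[OF W w(1)] by (metis subsetI)
      then show False
        using subspace_carrier_vecD[OF W] \<open>W \<noteq> carrier_vec 1\<close> by auto
    qed
  qed
qed (use assms in auto)

section \<open>One-dimensional representations and characters\<close>

lemma (in comm_group) irreps_iff: "\<sigma> \<in> irreps G \<longleftrightarrow> rep G 1 \<sigma>"
proof
  assume "\<sigma> \<in> irreps G"
  then obtain n where irr: "irreducible_rep G n \<sigma>"
    by (auto simp: irreps_def)
  then show "rep G 1 \<sigma>"
    using irreducible_rep_dim[OF irr] unfolding irreducible_rep_def by blast
next
  assume "rep G 1 \<sigma>"
  then show "\<sigma> \<in> irreps G"
    using irreducible_rep_1 unfolding irreps_def by blast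
qed

text \<open>Meant for one-dimensional representations, whose single entry is also the trace. The
  restriction makes the result extensional, as \<open>characters\<close> demands.\<close>

definition rep_character :: "('g, 'm) monoid_scheme \<Rightarrow> ('g \<Rightarrow> complex mat) \<Rightarrow> 'g \<Rightarrow> complex" where
  "rep_character G \<sigma> = restrict (\<lambda>g. \<sigma> g $$ (0, 0)) (carrier G)"

definition character_rep :: "('g \<Rightarrow> complex) \<Rightarrow> 'g \<Rightarrow> complex mat" where
  "character_rep \<eta> = (\<lambda>g. Matrix.mat 1 1 (\<lambda>_. \<eta> g))"

lemma rep_character_in_characters:
  assumes "group G" "rep G 1 \<sigma>"
  shows "rep_character G \<sigma> \<in> characters G"
proof -
  interpret group G by fact
  show ?thesis
    using rep_one[OF assms] rep_mult[OF assms(2)] index_mult_mat_1[OF rep_carrier rep_carrier, OF assms(2) _ assms(2)]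
    by (simp add: characters_def rep_character_def)
qed

lemma rep_1_character_rep:
  assumes "group G" "\<eta> \<in> characters G"
  shows "rep G 1 (character_rep \<eta>)"
  using assms
  by (intro repI) (auto simp: character_rep_def characters_one characters_mult scalar_prod_def)

lemma rep_character_character_rep:
  assumes "\<eta> \<in> characters G"
  shows "rep_character G (character_rep \<eta>) = \<eta>"
  using assms
  by (intro extensionalityI[of _ "carrier G"])
     (auto simp: rep_character_def character_rep_def characters_extensional)

text \<open>Similarity preserves the trace, which for a 1 by 1 matrix is its entry. Conversely,
  equal characters mean equal matrices on the group, and the identity serves as the
  similarity.\<close>

lemma rep_iso_1_iff:
  assumes "rep G 1 \<sigma>" "rep G 1 \<tau>"
  shows "rep_iso G \<sigma> \<tau> \<longleftrightarrow> rep_character G \<sigma> = rep_character G \<tau>"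
proof
  assume "rep_iso G \<sigma> \<tau>"
  then obtain P Q where *: "\<And>g. g \<in> carrier G \<Longrightarrow> similar_mat_wit (\<sigma> g) (\<tau> g) P Q"
    by (auto simp: rep_iso_def)
  show "rep_character G \<sigma> = rep_character G \<tau>"
    unfolding rep_character_def
  proof (rule restrict_ext)
    fix g assume g: "g \<in> carrier G"
    show "\<sigma> g $$ (0, 0) = \<tau> g $$ (0, 0)"
      using mat_trace_similar[OF *[OF g]] rep_carrier[OF assms(1) g] rep_carrier[OF assms(2) g]
      by (simp add: mat_trace_def)
  qed
next
  assume eq: "rep_character G \<sigma> = rep_character G \<tau>"
  have "similar_mat_wit (\<sigma> g) (\<tau> g) (1\<^sub>m 1) (1\<^sub>m 1)" if g: "g \<in> carrier G" for g
  proof -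
    have "\<sigma> g = \<tau> g"
      using fun_cong[OF eq, of g] g rep_carrier[OF assms(1) g] rep_carrier[OF assms(2) g]
      by (intro eq_matI) (auto simp: rep_character_def)
    then show ?thesis
      using rep_carrier[OF assms(2) g] by (auto simp: similar_mat_wit_def Let_def)
  qed
  then show "rep_iso G \<sigma> \<tau>"
    using assms unfolding rep_iso_def by blast
qed

lemma mat_trace_rep_sum:
  assumes "\<And>\<sigma>. \<sigma> \<in> set \<sigma>s \<Longrightarrow> rep G 1 \<sigma>" "g \<in> carrier G"
  shows "mat_trace (rep_sum \<sigma>s g) = (\<Sum>\<sigma>\<leftarrow>\<sigma>s. rep_character G \<sigma> g)"
proof -
  have "mat_trace (rep_sum \<sigma>s g) = (\<Sum>\<sigma>\<leftarrow>\<sigma>s. mat_trace (\<sigma> g))"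
    unfolding rep_sum_def
    by (subst mat_trace_diag_block_mat) (use assms rep_carrier in \<open>fastforce simp: o_def\<close>)+
  also have "\<dots> = (\<Sum>\<sigma>\<leftarrow>\<sigma>s. rep_character G \<sigma> g)"
    using assms(2) mat_trace_1[OF rep_carrier[OF assms]]
    by (intro arg_cong[of _ _ sum_list] map_cong) (simp_all add: rep_character_def)
  finally show ?thesis .
qed

section \<open>Multiplicities as character sums\<close>

locale finite_comm_group = finite_group + comm_group
begin

text \<open>The right-hand side does not mention the decomposition, so the definite description in
  \<^const>\<open>multiplicity_in\<close> is never applied to a non-unique predicate.\<close>

lemma decomposition_count:
  assumes \<sigma>': "\<sigma>' \<in> irreps G" and \<sigma>s: "set \<sigma>s \<subseteq> irreps G" and iso: "rep_iso G \<tau> (rep_sum \<sigma>s)"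
  shows "of_nat (length (filter (rep_iso G \<sigma>') \<sigma>s)) =
    (\<Sum>g\<in>carrier G. mat_trace (\<tau> g) * cnj (rep_character G \<sigma>' g)) / of_nat (order G)"
proof -
  have rep: "rep G 1 \<sigma>" if "\<sigma> \<in> set \<sigma>s" for \<sigma>
    using that \<sigma>s by (auto simp: irreps_iff)
  have rep': "rep G 1 \<sigma>'"
    using \<sigma>' by (simp add: irreps_iff)
  have tr: "mat_trace (\<tau> g) = (\<Sum>\<sigma>\<leftarrow>\<sigma>s. rep_character G \<sigma> g)" if "g \<in> carrier G" for g
  proof -
    obtain P Q where "\<forall>g\<in>carrier G. similar_mat_wit (\<tau> g) (rep_sum \<sigma>s g) P Q"
      using iso by (auto simp: rep_iso_def)
    then have "mat_trace (\<tau> g) = mat_trace (rep_sum \<sigma>s g)"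
      using that by (intro mat_trace_similar) (rule bspec)
    then show ?thesis
      using mat_trace_rep_sum[OF rep that] by simp
  qed
  have "(\<Sum>g\<in>carrier G. mat_trace (\<tau> g) * cnj (rep_character G \<sigma>' g)) =
      (\<Sum>g\<in>carrier G. (\<Sum>\<sigma>\<leftarrow>\<sigma>s. rep_character G \<sigma> g) * cnj (rep_character G \<sigma>' g))"
    by (simp add: tr)
  \<comment> \<open>By row orthogonality each summand contributes the group order if its character
    is that of \<open>\<sigma>'\<close>, and 0 otherwise.\<close>
  also have "\<dots> = of_nat (order G) * of_nat (length (filter (rep_iso G \<sigma>') \<sigma>s))"
    using rep
  proof (induction \<sigma>s)
    case (Cons \<sigma> \<sigma>s)
    have "rep G 1 \<sigma>"
      using Cons.prems by simp
    then show ?case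
      using Cons.IH Cons.prems rep'
        characters_row_orthogonal[of "rep_character G \<sigma>" "rep_character G \<sigma>'"]
      by (auto simp: distrib_right sum.distrib rep_iso_1_iff rep_character_in_characters[OF is_group]
          distrib_left)
  qed simp
  finally show ?thesis
    using order_pos by simp
qed

text \<open>The given decomposition is a witness for the definite description. Any other one yields
  the same count, since \<open>decomposition_count\<close> determines it from \<open>\<tau>\<close>
  and \<open>\<sigma>'\<close> alone.\<close>

lemma multiplicity_in_eq:
  assumes \<sigma>': "\<sigma>' \<in> irreps G" and \<sigma>s: "set \<sigma>s \<subseteq> irreps G" and iso: "rep_iso G \<tau> (rep_sum \<sigma>s)"
  shows "of_nat (multiplicity_in G \<sigma>' \<tau>) =
    (\<Sum>g\<in>carrier G. mat_trace (\<tau> g) * cnj (rep_character G \<sigma>' g)) / of_nat (order G)"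
proof -
  have "multiplicity_in G \<sigma>' \<tau> = length (filter (rep_iso G \<sigma>') \<sigma>s)"
    unfolding multiplicity_in_def
  proof (rule the_equality)
    show "\<exists>\<sigma>s'. set \<sigma>s' \<subseteq> irreps G \<and> rep_iso G \<tau> (rep_sum \<sigma>s') \<and>
        length (filter (rep_iso G \<sigma>') \<sigma>s) = length (filter (rep_iso G \<sigma>') \<sigma>s')"
      using \<sigma>s iso by blast
    fix k assume "\<exists>\<sigma>s'. set \<sigma>s' \<subseteq> irreps G \<and> rep_iso G \<tau> (rep_sum \<sigma>s') \<and>
        k = length (filter (rep_iso G \<sigma>') \<sigma>s')"
    then have "of_nat k = (of_nat (length (filter (rep_iso G \<sigma>') \<sigma>s)) :: complex)"
      using decomposition_count[OF \<sigma>'] \<sigma>s iso by force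
    then show "k = length (filter (rep_iso G \<sigma>') \<sigma>s)"
      by simp
  qed
  then show ?thesis
    using decomposition_count[OF assms] by simp
qed

end

section \<open>McKay graphs of diagonal groups\<close>

lemma mat_adjoint_eq:
  "mat_adjoint A = Matrix.mat (dim_col A) (dim_row A) (\<lambda>(i, j). conjugate (A $$ (j, i)))"
  by (intro eq_matI) (auto simp: mat_adjoint_def mat_of_rows_def)

lemma mat_adjoint_carrier: "A \<in> carrier_mat n m \<Longrightarrow> mat_adjoint A \<in> carrier_mat m n"
  by (auto simp: mat_adjoint_eq)

lemma mat_adjoint_mult:
  fixes A B :: "complex mat"
  assumes "A \<in> carrier_mat n m" "B \<in> carrier_mat m k"
  shows "mat_adjoint (A * B) = mat_adjoint B * mat_adjoint A"
  using assms by (intro eq_matI) (auto simp: mat_adjoint_eq scalar_prod_def mult.commute)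

lemma mat_adjoint_adjoint: "mat_adjoint (mat_adjoint A) = (A :: complex mat)"
  by (intro eq_matI) (auto simp: mat_adjoint_eq)

text \<open>The inverse is the adjoint. \<open>SU\<close> states unitarity on one side only, but a
  one-sided inverse of a square matrix is two-sided. The adjoint has determinant 1 because the
  determinant is multiplicative.\<close>

lemma group_SU: "group (SU n)"
proof (rule groupI)
  fix A B assume AB: "A \<in> carrier (SU n)" "B \<in> carrier (SU n)"
  then have carr: "A \<in> carrier_mat n n" "B \<in> carrier_mat n n" "mat_adjoint A \<in> carrier_mat n n"
    "mat_adjoint B \<in> carrier_mat n n"
    by (auto simp: SU_def mat_adjoint_carrier)
  have "A * B * mat_adjoint (A * B) = A * (B * mat_adjoint B * mat_adjoint A)"
    using carr by (simp add: mat_adjoint_mult[of _ n n] assoc_mult_mat[of _ n n _ n _ n])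
  also have "\<dots> = 1\<^sub>m n"
    using AB carr by (simp add: SU_def)
  finally show "A \<otimes>\<^bsub>SU n\<^esub> B \<in> carrier (SU n)"
    using AB by (simp add: SU_def det_mult[of A n B] mult_carrier_mat[of A n n B n])
next
  have "mat_adjoint (1\<^sub>m n) = (1\<^sub>m n :: complex mat)"
    by (intro eq_matI) (auto simp: mat_adjoint_eq)
  then show "\<one>\<^bsub>SU n\<^esub> \<in> carrier (SU n)"
    by (simp add: SU_def)
next
  fix A assume A: "A \<in> carrier (SU n)"
  then have carr: "A \<in> carrier_mat n n" "mat_adjoint A \<in> carrier_mat n n"
    and right: "A * mat_adjoint A = 1\<^sub>m n" and det: "Determinant.det A = 1"
    by (auto simp: SU_def mat_adjoint_carrier)
  have left: "mat_adjoint A * A = 1\<^sub>m n"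
    by (rule mat_mult_left_right_inverse[OF carr right])
  have "Determinant.det A * Determinant.det (mat_adjoint A) = 1"
    using det_mult[OF carr] right by simp
  then have "mat_adjoint A \<in> carrier (SU n)"
    using carr left det by (simp add: SU_def mat_adjoint_adjoint)
  then show "\<exists>B\<in>carrier (SU n). B \<otimes>\<^bsub>SU n\<^esub> A = \<one>\<^bsub>SU n\<^esub>"
    using left by (auto simp: SU_def)
qed (auto simp: SU_def)

lemma diagonal_mat_mult_index:
  fixes A B :: "'a :: semiring_0 mat"
  assumes "A \<in> carrier_mat n n" "B \<in> carrier_mat n n" "diagonal_mat A" "diagonal_mat B" "i < n" "j < n"
  shows "(A * B) $$ (i, j) = (if i = j then A $$ (i, i) * B $$ (i, i) else 0)"
proof -
  have "(A * B) $$ (i, j) = (\<Sum>k<n. A $$ (i, k) * B $$ (k, j))"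
    using assms by (auto simp: scalar_prod_def lessThan_atLeast0)
  also have "\<dots> = (\<Sum>k<n. if k = i then A $$ (i, i) * B $$ (i, j) else 0)"
    using assms by (intro sum.cong) (auto simp: diagonal_mat_def)
  also have "\<dots> = A $$ (i, i) * B $$ (i, j)"
    using assms by simp
  finally show ?thesis
    using assms by (auto simp: diagonal_mat_def)
qed

lemma group_of_simps:
  "carrier (group_of \<Gamma>) = \<Gamma>" "mult (group_of \<Gamma>) = (*)" "one (group_of \<Gamma>) = 1\<^sub>m 3"
  by (auto simp: group_of_def SU_def)

section \<open>Finite groups of diagonal matrices\<close>

locale finite_diagonal_subgroup =
  fixes \<Gamma> :: "complex mat set"
  assumes subgroup_SU: "subgroup \<Gamma> (SU 3)"
    and finite: "finite \<Gamma>"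
    and diagonal: "A \<in> \<Gamma> \<Longrightarrow> diagonal_mat A"
begin

lemma carrier_3: "A \<in> \<Gamma> \<Longrightarrow> A \<in> carrier_mat 3 3"
  using subgroup.subset[OF subgroup_SU] by (auto simp: SU_def)

lemma mult_index:
  assumes "A \<in> \<Gamma>" "B \<in> \<Gamma>" "i < 3" "j < 3"
  shows "(A * B) $$ (i, j) = (if i = j then A $$ (i, i) * B $$ (i, i) else 0)"
  by (rule diagonal_mat_mult_index[OF carrier_3 carrier_3 diagonal diagonal, OF assms(1,2,1,2,3,4)])

sublocale finite_comm_group "group_of \<Gamma>"
proof -
  interpret group "group_of \<Gamma>"
    unfolding group_of_def by (rule subgroup.subgroup_is_group[OF subgroup_SU group_SU])
  show "finite_comm_group (group_of \<Gamma>)"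
  proof
    fix A B assume "A \<in> carrier (group_of \<Gamma>)" "B \<in> carrier (group_of \<Gamma>)"
    then have AB: "A \<in> \<Gamma>" "B \<in> \<Gamma>"
      by (simp_all add: group_of_simps)
    show "A \<otimes>\<^bsub>group_of \<Gamma>\<^esub> B = B \<otimes>\<^bsub>group_of \<Gamma>\<^esub> A"
      unfolding group_of_simps
      using carrier_3[OF AB(1)] carrier_3[OF AB(2)]
      by (intro eq_matI) (auto simp: mult_index[OF AB] mult_index[OF AB(2,1)] mult.commute simp del: index_mult_mat(1))
  qed (simp add: group_of_simps finite)
qed

text \<open>Diagonal matrices multiply entrywise along the diagonal. These three characters are the
  constituents of the inclusion representation.\<close>

lemma entry_character:
  assumes "i < 3"
  shows "restrict (\<lambda>A. A $$ (i, i)) \<Gamma> \<in> characters (group_of \<Gamma>)"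
  using assms m_closed one_closed
  by (auto simp: characters_def group_of_simps mult_index simp del: index_mult_mat(1))

text \<open>Supplies the separation hypothesis of column orthogonality: a diagonal matrix on which
  the three entry characters are all 1 is the identity.\<close>

lemma characters_separate:
  assumes "A \<in> carrier (group_of \<Gamma>)" "A \<noteq> \<one>\<^bsub>group_of \<Gamma>\<^esub>"
  shows "\<exists>\<eta>\<in>characters (group_of \<Gamma>). \<eta> A \<noteq> 1"
proof (rule ccontr)
  assume *: "\<not> ?thesis"
  have A: "A \<in> \<Gamma>"
    using assms by (simp add: group_of_simps)
  have "A $$ (i, i) = 1" if "i < 3" for i
    using * entry_character[OF that] A by force
  then have "A = 1\<^sub>m 3"
    using carrier_3[OF A] diagonal[OF A] by (intro eq_matI) (auto simp: diagonal_mat_def)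
  then show False
    using assms by (simp add: group_of_simps)
qed

section \<open>Vertices of the McKay graph as characters\<close>

definition vertex_of :: "(complex mat \<Rightarrow> complex) \<Rightarrow> vertex" where
  "vertex_of \<eta> = {\<sigma> \<in> irreps (group_of \<Gamma>). rep_character (group_of \<Gamma>) \<sigma> = \<eta>}"

lemma character_rep_in_vertex_of:
  assumes "\<eta> \<in> characters (group_of \<Gamma>)"
  shows "character_rep \<eta> \<in> vertex_of \<eta>"
  using rep_1_character_rep[OF is_group assms] rep_character_character_rep[OF assms]
  unfolding vertex_of_def irreps_iff by blast

lemma some_vertex_of:
  assumes "\<eta> \<in> characters (group_of \<Gamma>)"
  shows "(SOME \<sigma>. \<sigma> \<in> vertex_of \<eta>) \<in> irreps (group_of \<Gamma>)"
    and "rep_character (group_of \<Gamma>) (SOME \<sigma>. \<sigma> \<in> vertex_of \<eta>) = \<eta>"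
  using someI[of "\<lambda>\<sigma>. \<sigma> \<in> vertex_of \<eta>", OF character_rep_in_vertex_of[OF assms]]
  by (simp_all add: vertex_of_def)

text \<open>Irreducible representations are one-dimensional, so each isomorphism class consists of
  all those with one fixed character, and \<open>character_rep\<close> shows that every character
  occurs.\<close>

lemma mckay_vertices_eq: "mckay_vertices \<Gamma> = vertex_of ` characters (group_of \<Gamma>)"
proof -
  let ?R = "{(\<sigma>, \<tau>). \<sigma> \<in> irreps (group_of \<Gamma>) \<and> \<tau> \<in> irreps (group_of \<Gamma>) \<and> rep_iso (group_of \<Gamma>) \<sigma> \<tau>}"
  have class_eq: "?R `` {\<sigma>} = vertex_of (rep_character (group_of \<Gamma>) \<sigma>)" if "\<sigma> \<in> irreps (group_of \<Gamma>)" for \<sigma>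
    using that by (auto simp: vertex_of_def irreps_iff rep_iso_1_iff)
  have "rep_character (group_of \<Gamma>) ` irreps (group_of \<Gamma>) = characters (group_of \<Gamma>)"
    using rep_character_in_characters[OF is_group] some_vertex_of
    by (auto simp: irreps_iff) (metis irreps_iff image_eqI mem_Collect_eq One_nat_def)
  moreover have "mckay_vertices \<Gamma> = (\<lambda>\<sigma>. vertex_of (rep_character (group_of \<Gamma>) \<sigma>)) ` irreps (group_of \<Gamma>)"
    using class_eq by (auto simp: mckay_vertices_def quotient_def)
  ultimately show ?thesis
    by (simp add: image_image[symmetric])
qed

lemma inj_on_vertex_of: "inj_on vertex_of (characters (group_of \<Gamma>))"
  using some_vertex_of(2) by (metis inj_onI)

lemma sum_mckay_vertices:
  "(\<Sum>X\<in>mckay_vertices \<Gamma>. f X) = (\<Sum>\<eta>\<in>characters (group_of \<Gamma>). f (vertex_of \<eta>))"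
  by (simp add: mckay_vertices_eq sum.reindex[OF inj_on_vertex_of])

text \<open>Tensoring the diagonal matrix \<open>g\<close> with a 1 by 1 matrix only rescales its
  entries, so the tensor product is visibly a direct sum of three one-dimensional representations,
  and \<open>multiplicity_in_eq\<close> applies with trace
  \<open>mat_trace g * \<eta> g\<close>.\<close>

lemma multiplicity_in_tensor:
  assumes \<sigma>: "\<sigma> \<in> irreps (group_of \<Gamma>)" and \<sigma>': "\<sigma>' \<in> irreps (group_of \<Gamma>)"
  shows "of_nat (multiplicity_in (group_of \<Gamma>) \<sigma>' (rep_tensor (\<lambda>g. g) \<sigma>)) =
    (\<Sum>g\<in>\<Gamma>. mat_trace g * rep_character (group_of \<Gamma>) \<sigma> g * cnj (rep_character (group_of \<Gamma>) \<sigma>' g)) /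
      of_nat (card \<Gamma>)"
proof -
  let ?G = "group_of \<Gamma>"
  define \<eta> where "\<eta> = rep_character ?G \<sigma>"
  \<comment> \<open>The three constituents: the entry characters multiplied by
    \<open>\<eta>\<close>.\<close>
  define \<theta> where "\<theta> i = restrict (\<lambda>g. g $$ (i, i) * \<eta> g) \<Gamma>" for i
  define \<sigma>s where "\<sigma>s = map (\<lambda>i. character_rep (\<theta> i)) [0..<3]"
  have rep: "rep ?G 1 \<sigma>"
    using \<sigma> by (simp add: irreps_iff)
  have \<eta>: "\<eta> \<in> characters ?G"
    unfolding \<eta>_def by (rule rep_character_in_characters[OF is_group rep])
  have \<theta>: "\<theta> i \<in> characters ?G" if "i < 3" for i
    using characters_times[OF entry_character[OF that] \<eta>]
    by (simp add: \<theta>_def group_of_simps cong: restrict_cong)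
  have tensor: "rep_tensor (\<lambda>g. g) \<sigma> g = mat_diag 3 (\<lambda>i. \<theta> i g)" if g: "g \<in> \<Gamma>" for g
    using carrier_3[OF g] diagonal[OF g] rep_carrier[OF rep, of g] g
    by (intro eq_matI)
       (auto simp: rep_tensor_def kronecker_def mat_diag_def diagonal_mat_def \<theta>_def \<eta>_def
          rep_character_def group_of_simps)
  have "mat_diag 3 f = diag_block_mat (map (\<lambda>i. Matrix.mat 1 1 (\<lambda>_. f i)) [0..<3])" for f :: "nat \<Rightarrow> complex"
    by (intro eq_matI) (auto simp: mat_diag_def numeral_3_eq_3 less_Suc_eq Let_def)
  then have sum: "rep_sum \<sigma>s g = mat_diag 3 (\<lambda>i. \<theta> i g)" for g
    by (simp add: rep_sum_def \<sigma>s_def character_rep_def o_def)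
  \<comment> \<open>Stated for any \<open>\<tau>\<close> with these values, so that it covers both
    the tensor product and the block sum; \<open>rep_iso\<close> asks that both be
    representations.\<close>
  have rep_diag: "rep ?G 3 \<tau>" if \<tau>: "\<And>g. g \<in> \<Gamma> \<Longrightarrow> \<tau> g = mat_diag 3 (\<lambda>i. \<theta> i g)" for \<tau>
  proof (rule repI[OF is_group])
    show "\<tau> g \<in> carrier_mat 3 3" if "g \<in> carrier ?G" for g
      using that by (simp add: \<tau> group_of_simps)
    have "\<tau> (\<one>\<^bsub>?G\<^esub>) = mat_diag 3 (\<lambda>i. \<theta> i \<one>\<^bsub>?G\<^esub>)"
      using \<tau> one_closed by (simp add: group_of_simps)
    also have "\<dots> = mat_diag 3 (\<lambda>_. 1)"
      using \<theta> by (intro eq_matI) (auto simp: mat_diag_def characters_one)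
    finally show "\<tau> (\<one>\<^bsub>?G\<^esub>) = 1\<^sub>m 3"
      by simp
    fix g h assume gh: "g \<in> carrier ?G" "h \<in> carrier ?G"
    have "\<tau> (g \<otimes>\<^bsub>?G\<^esub> h) = mat_diag 3 (\<lambda>i. \<theta> i (g \<otimes>\<^bsub>?G\<^esub> h))"
      using \<tau> m_closed[OF gh] by (simp add: group_of_simps)
    also have "\<dots> = mat_diag 3 (\<lambda>i. \<theta> i g * \<theta> i h)"
      using \<theta> gh by (intro eq_matI) (auto simp: mat_diag_def characters_mult)
    also have "\<dots> = \<tau> g * \<tau> h"
      using \<tau> gh by (simp add: group_of_simps)
    finally show "\<tau> (g \<otimes>\<^bsub>?G\<^esub> h) = \<tau> g * \<tau> h" .
  qed
  \<comment> \<open>Both sides are the same diagonal matrix, so the identity is a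
    similarity.\<close>
  have "\<forall>g\<in>carrier ?G. similar_mat_wit (rep_tensor (\<lambda>g. g) \<sigma> g) (rep_sum \<sigma>s g) (1\<^sub>m 3) (1\<^sub>m 3)"
  proof
    fix g assume "g \<in> carrier ?G"
    then have g: "g \<in> \<Gamma>" by (simp add: group_of_simps)
    show "similar_mat_wit (rep_tensor (\<lambda>g. g) \<sigma> g) (rep_sum \<sigma>s g) (1\<^sub>m 3) (1\<^sub>m 3)"
      unfolding tensor[OF g] sum by (rule similar_mat_wit_refl) simp
  qed
  then have iso: "rep_iso ?G (rep_tensor (\<lambda>g. g) \<sigma>) (rep_sum \<sigma>s)"
    using rep_diag[OF tensor] rep_diag[OF sum] unfolding rep_iso_def by blast
  have \<sigma>s: "set \<sigma>s \<subseteq> irreps ?G"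
    using \<theta> by (auto simp: \<sigma>s_def irreps_iff rep_1_character_rep[OF is_group] simp del: One_nat_def)
  have "mat_trace (rep_tensor (\<lambda>g. g) \<sigma> g) = mat_trace g * \<eta> g" if g: "g \<in> \<Gamma>" for g
    unfolding tensor[OF g] using carrier_3[OF g] g
    by (simp add: mat_trace_def mat_diag_def \<theta>_def sum_distrib_right)
  then show ?thesis
    unfolding multiplicity_in_eq[OF \<sigma>' \<sigma>s iso] by (simp add: \<eta>_def order_def group_of_simps)
qed

section \<open>Diagonalization of the adjacency matrix and the moments\<close>

lemma mckay_adjacency_vertex_of:
  assumes \<eta>: "\<eta> \<in> characters (group_of \<Gamma>)" and \<theta>: "\<theta> \<in> characters (group_of \<Gamma>)"
  shows "mckay_adjacency \<Gamma> (vertex_of \<eta>) (vertex_of \<theta>) =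
    (\<Sum>g\<in>\<Gamma>. mat_trace g * \<eta> g * cnj (\<theta> g)) / of_nat (card \<Gamma>)"
  \<comment> \<open>The chosen representatives enter only through their characters, which are
    \<open>\<eta>\<close> and \<open>\<theta>\<close>.\<close>
  unfolding mckay_adjacency_def
  by (simp add: multiplicity_in_tensor some_vertex_of[OF \<eta>] some_vertex_of[OF \<theta>])

text \<open>The vectors \<open>\<eta> \<mapsto> \<eta> g\<close>, for \<open>g \<in> \<Gamma>\<close>, simultaneously diagonalize all matrices of this shape.\<close>

lemma apply_matrix_character_sum:
  assumes A: "\<And>\<eta> \<theta>. \<eta> \<in> characters (group_of \<Gamma>) \<Longrightarrow> \<theta> \<in> characters (group_of \<Gamma>) \<Longrightarrow>
      A (vertex_of \<eta>) (vertex_of \<theta>) = (\<Sum>g\<in>\<Gamma>. t g * \<eta> g * cnj (\<theta> g)) / of_nat (card \<Gamma>)"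
    and x: "\<And>\<eta>. \<eta> \<in> characters (group_of \<Gamma>) \<Longrightarrow>
      x (vertex_of \<eta>) = (\<Sum>g\<in>\<Gamma>. c g * \<eta> g) / of_nat (card \<Gamma>)"
    and \<eta>: "\<eta> \<in> characters (group_of \<Gamma>)"
  shows "apply_matrix (mckay_vertices \<Gamma>) A x (vertex_of \<eta>) =
    (\<Sum>g\<in>\<Gamma>. (t g * c g) * \<eta> g) / of_nat (card \<Gamma>)"
proof -
  let ?N = "of_nat (card \<Gamma>) :: complex"
  have N: "?N \<noteq> 0"
    using order_pos by (simp add: order_def group_of_simps)
  have column: "(\<Sum>\<theta>\<in>characters (group_of \<Gamma>). cnj (\<theta> g) * \<theta> h) = (if g = h then ?N else 0)"
    if "g \<in> \<Gamma>" "h \<in> \<Gamma>" for g h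
    using characters_column_orthogonal[OF characters_separate, of g h] that
    by (simp add: order_def group_of_simps)
  have "apply_matrix (mckay_vertices \<Gamma>) A x (vertex_of \<eta>) =
      (\<Sum>\<theta>\<in>characters (group_of \<Gamma>).
        (\<Sum>g\<in>\<Gamma>. t g * \<eta> g * cnj (\<theta> g)) / ?N * ((\<Sum>h\<in>\<Gamma>. c h * \<theta> h) / ?N))"
    by (simp add: apply_matrix_def sum_mckay_vertices A[OF \<eta>] x)
  also have "\<dots> = (\<Sum>\<theta>\<in>characters (group_of \<Gamma>). \<Sum>g\<in>\<Gamma>. \<Sum>h\<in>\<Gamma>.
      t g * \<eta> g * c h * (cnj (\<theta> g) * \<theta> h)) / ?N\<^sup>2"
    unfolding times_divide_times_eq sum_product sum_divide_distrib[symmetric]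
    by (simp add: power2_eq_square mult_ac)
  also have "(\<Sum>\<theta>\<in>characters (group_of \<Gamma>). \<Sum>g\<in>\<Gamma>. \<Sum>h\<in>\<Gamma>. t g * \<eta> g * c h * (cnj (\<theta> g) * \<theta> h)) =
      (\<Sum>g\<in>\<Gamma>. \<Sum>h\<in>\<Gamma>. t g * \<eta> g * c h * (\<Sum>\<theta>\<in>characters (group_of \<Gamma>). cnj (\<theta> g) * \<theta> h))"
    by (subst sum.swap, intro sum.cong refl, subst sum.swap) (simp add: sum_distrib_left)
  \<comment> \<open>Column orthogonality keeps only \<open>h = g\<close>, with a factor
    \<open>?N\<close> that cancels one of the two denominators.\<close>
  also have "\<dots> = (\<Sum>g\<in>\<Gamma>. t g * \<eta> g * c g * ?N)"
    using finite by (intro sum.cong refl) (simp add: column if_distrib[of "\<lambda>x. _ * x"] cong: if_cong)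
  also have "\<dots> / ?N\<^sup>2 = (\<Sum>g\<in>\<Gamma>. (t g * c g) * \<eta> g) / ?N"
    using N by (simp add: sum_divide_distrib power2_eq_square mult_ac)
  finally show ?thesis .
qed

text \<open>In the basis of vectors \<open>\<eta> \<mapsto> \<eta> g\<close>, the vector of the
  trivial representation has constant coefficients, and each application of the adjoint or of the
  matrix itself multiplies the coefficient at \<open>g\<close> by \<open>cnj (mat_trace g)\<close>
  or \<open>mat_trace g\<close>. The final inner product evaluates at the trivial character, where
  all basis vectors are 1.\<close>

lemma mckay_moment_eq:
  "mckay_moment \<Gamma> m n = (\<Sum>g\<in>\<Gamma>. mat_trace g ^ m * cnj (mat_trace g) ^ n) / of_nat (card \<Gamma>)"
proof -
  let ?N = "of_nat (card \<Gamma>) :: complex"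
  let ?V = "mckay_vertices \<Gamma>" and ?\<Delta> = "mckay_adjacency \<Gamma>"
  define triv :: "complex mat \<Rightarrow> complex" where "triv = restrict (\<lambda>_. 1) \<Gamma>"
  have triv: "triv \<in> characters (group_of \<Gamma>)"
    using m_closed one_closed by (auto simp: triv_def characters_def group_of_simps)
  have "rep (group_of \<Gamma>) 1 trivial_rep"
    by (intro repI[OF is_group]) (auto simp: trivial_rep_def)
  then have e: "trivial_vector (vertex_of \<eta>) = (if \<eta> = triv then 1 else 0)" for \<eta>
    by (auto simp: trivial_vector_def vertex_of_def irreps_iff rep_character_def trivial_rep_def
        triv_def group_of_simps cong: restrict_cong)
  have N: "?N \<noteq> 0"
    using order_pos by (simp add: order_def group_of_simps)
  \<comment> \<open>Row orthogonality against the trivial character gives the coefficients, all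
    equal to 1.\<close>
  have e_sum: "trivial_vector (vertex_of \<eta>) = (\<Sum>g\<in>\<Gamma>. 1 * \<eta> g) / ?N"
    if "\<eta> \<in> characters (group_of \<Gamma>)" for \<eta>
    using characters_row_orthogonal[OF that triv] N
    by (simp add: e order_def group_of_simps) (simp add: triv_def)
  \<comment> \<open>Conjugating and exchanging \<open>\<eta>\<close> with \<open>\<theta>\<close>
    preserves the shape and conjugates only the eigenvalue, so the adjoint has the same
    eigenvectors.\<close>
  have adj: "adjoint_matrix ?\<Delta> (vertex_of \<eta>) (vertex_of \<theta>) =
      (\<Sum>g\<in>\<Gamma>. cnj (mat_trace g) * \<eta> g * cnj (\<theta> g)) / ?N"
    if "\<eta> \<in> characters (group_of \<Gamma>)" "\<theta> \<in> characters (group_of \<Gamma>)" for \<eta> \<theta>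
    using that by (simp add: adjoint_matrix_def mckay_adjacency_vertex_of mult_ac)
  have n: "(apply_matrix ?V (adjoint_matrix ?\<Delta>) ^^ n) trivial_vector (vertex_of \<eta>) =
      (\<Sum>g\<in>\<Gamma>. cnj (mat_trace g) ^ n * \<eta> g) / ?N" if "\<eta> \<in> characters (group_of \<Gamma>)" for \<eta>
    using that
  proof (induction n arbitrary: \<eta>)
    case 0
    then show ?case by (simp add: e_sum)
  next
    case (Suc n)
    show ?case
      unfolding funpow.simps o_apply power_Suc
      by (rule apply_matrix_character_sum[where A = "adjoint_matrix ?\<Delta>" and t = "\<lambda>g. cnj (mat_trace g)"
            and c = "\<lambda>g. cnj (mat_trace g) ^ n", OF adj Suc.IH Suc.prems])
  qed
  have m: "(apply_matrix ?V ?\<Delta> ^^ m) ((apply_matrix ?V (adjoint_matrix ?\<Delta>) ^^ n) trivial_vector) (vertex_of \<eta>) =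
      (\<Sum>g\<in>\<Gamma>. (mat_trace g ^ m * cnj (mat_trace g) ^ n) * \<eta> g) / ?N"
    if "\<eta> \<in> characters (group_of \<Gamma>)" for \<eta>
    using that
  proof (induction m arbitrary: \<eta>)
    case 0
    then show ?case by (simp add: n)
  next
    case (Suc m)
    show ?case
      unfolding funpow.simps o_apply power_Suc mult.assoc[of "mat_trace _" "mat_trace _ ^ m"]
      by (rule apply_matrix_character_sum[where A = ?\<Delta> and t = mat_trace
            and c = "\<lambda>g. mat_trace g ^ m * cnj (mat_trace g) ^ n",
            OF mckay_adjacency_vertex_of Suc.IH Suc.prems])
  qed
  \<comment> \<open>Only the vertex of the trivial character survives in the inner product.\<close>
  have "mckay_moment \<Gamma> m n = (\<Sum>\<eta>\<in>characters (group_of \<Gamma>).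
      if \<eta> = triv then (\<Sum>g\<in>\<Gamma>. (mat_trace g ^ m * cnj (mat_trace g) ^ n) * \<eta> g) / ?N else 0)"
    by (simp add: mckay_moment_def inner_on_def Let_def sum_mckay_vertices e m
        if_distrib[of "\<lambda>x. _ * x"] if_distrib[of cnj] cong: if_cong)
  also have "\<dots> = (\<Sum>g\<in>\<Gamma>. (mat_trace g ^ m * cnj (mat_trace g) ^ n) * triv g) / ?N"
    using triv finite_characters by simp
  finally show ?thesis
    by (simp add: triv_def)
qed

end

section \<open>The product of root measures\<close>

text \<open>Reconciles the product sigma-algebra carried by a product measure with the Borel sets of
  the torus that \<open>spectral_measure\<close> asks for. Second countability enters through
  \<open>borel_prod\<close>.\<close>

lemma sets_restrict_space_borel_Times:
  fixes S :: "'a :: second_countable_topology set" and T :: "'b :: second_countable_topology set"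
  assumes S: "S \<in> sets borel" and T: "T \<in> sets borel"
  shows "sets (restrict_space borel S \<Otimes>\<^sub>M restrict_space borel T) = sets (restrict_space borel (S \<times> T))"
    (is "sets ?P = sets ?R")
proof
  have ST: "S \<times> T \<in> sets borel"
    using S T by (rule borel_Times)
  show "sets ?P \<subseteq> sets ?R"
    using S T ST by (intro sets_pair_in_sets) (auto simp: sets_restrict_space_iff intro!: borel_Times)
  show "sets ?R \<subseteq> sets ?P"
  proof
    fix E assume "E \<in> sets ?R"
    then have E: "E \<in> sets borel" "E \<subseteq> S \<times> T"
      using ST by (auto simp: sets_restrict_space_iff)
    \<comment> \<open>Once the identity is measurable into the Borel sets of the product,
      \<open>E\<close> is measurable as its own preimage.\<close>
    have "(\<lambda>x. x) \<in> ?P \<rightarrow>\<^sub>M (borel \<Otimes>\<^sub>M borel)"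
      using measurable_compose[OF measurable_fst measurable_restrict_space1[OF measurable_ident_sets[OF refl]]]
        measurable_compose[OF measurable_snd measurable_restrict_space1[OF measurable_ident_sets[OF refl]]]
      by (intro measurable_pair) (simp_all add: comp_def)
    then have "(\<lambda>x. x) \<in> ?P \<rightarrow>\<^sub>M borel"
      by (simp add: borel_prod)
    from measurable_sets[OF this E(1)] show "E \<in> sets ?P"
      using E(2) by (simp add: space_pair_measure space_restrict_space Int_absorb2)
  qed
qed

section \<open>Root measures and their products\<close>

context
  fixes p :: nat
  assumes p: "p > 0"
begin

text \<open>The parameter \<open>p / 2\<close> turns the exponent \<open>2 * k\<close> into
  \<open>p\<close>, so the support is the set of \<open>p\<close>-th roots of unity.\<close>

lemma root_measure_half:
  "root_measure (real p / 2) =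
    distr (uniform_count_measure {z. z ^ p = 1}) (restrict_space borel circle) (\<lambda>z. z)"
  by (simp add: root_measure_def)

lemma roots_of_unity_circle: "{z :: complex. z ^ p = 1} \<subseteq> circle"
proof
  fix z :: complex assume "z \<in> {z. z ^ p = 1}"
  then have "norm z ^ p = 1"
    by (simp add: norm_power[symmetric])
  then show "z \<in> circle"
    using p power_eq_imp_eq_base[of "norm z" p 1] by simp
qed

lemma measurable_id_roots_of_unity:
  "(\<lambda>z. z) \<in> uniform_count_measure {z :: complex. z ^ p = 1} \<rightarrow>\<^sub>M restrict_space borel circle"
  using roots_of_unity_circle
  by (auto simp: measurable_def space_uniform_count_measure space_restrict_space
      sets_uniform_count_measure_count_space)

lemma prob_space_root_measure: "prob_space (root_measure (real p / 2))"
proof -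
  interpret prob_space "uniform_count_measure {z :: complex. z ^ p = 1}"
    using p by (intro prob_space_uniform_count_measure finite_roots_unity) (auto intro: exI[of _ 1])
  show ?thesis
    unfolding root_measure_half by (rule prob_space_distr[OF measurable_id_roots_of_unity])
qed

lemma integral_root_measure:
  fixes f :: "complex \<Rightarrow> complex"
  assumes "f \<in> borel_measurable (restrict_space borel circle)"
  shows "(\<integral>z. f z \<partial>root_measure (real p / 2)) = (\<Sum>z | z ^ p = 1. f z) / of_nat p"
proof -
  have "(\<integral>z. f z \<partial>root_measure (real p / 2)) = (\<integral>z. f z \<partial>uniform_count_measure {z. z ^ p = 1})"
    unfolding root_measure_half by (rule integral_distr[OF measurable_id_roots_of_unity assms])
  also have "\<dots> = (\<Sum>z | z ^ p = 1. f z) / of_nat p"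
    using p by (simp add: uniform_count_measure_def lebesgue_integral_point_measure_finite finite_roots_unity
        card_roots_unity_eq scaleR_conv_of_real sum_divide_distrib)
  finally show ?thesis .
qed

lemma sets_root_measure: "sets (root_measure (real p / 2)) = sets (restrict_space borel circle)"
  by (simp add: root_measure_half)

end

lemma sets_root_measure_pair:
  assumes "p > 0" "q > 0"
  shows "sets (root_measure (real p / 2) \<Otimes>\<^sub>M root_measure (real q / 2)) =
    sets (restrict_space borel (circle \<times> circle))"
  using sets_restrict_space_borel_Times[of circle circle]
    sets_pair_measure_cong[OF sets_root_measure[OF assms(1)] sets_root_measure[OF assms(2)]]
  by simp

text \<open>A continuous function on the compact torus is bounded, hence integrable for a
  probability measure. Fubini then reduces the integral to two finite averages.\<close>

lemma integral_root_measure_pair: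
  fixes f :: "complex \<times> complex \<Rightarrow> complex"
  assumes p: "p > 0" and q: "q > 0" and f: "continuous_on (circle \<times> circle) f"
  shows "integrable (root_measure (real p / 2) \<Otimes>\<^sub>M root_measure (real q / 2)) f" (is ?integrable)
    and "(\<integral>z. f z \<partial>(root_measure (real p / 2) \<Otimes>\<^sub>M root_measure (real q / 2))) =
      (\<Sum>z | z ^ p = 1. \<Sum>w | w ^ q = 1. f (z, w)) / of_nat (p * q)" (is ?integral)
proof -
  let ?M = "root_measure (real p / 2) \<Otimes>\<^sub>M root_measure (real q / 2)"
  interpret P: prob_space "root_measure (real p / 2)" by (rule prob_space_root_measure[OF p])
  interpret Q: prob_space "root_measure (real q / 2)" by (rule prob_space_root_measure[OF q])
  interpret PQ: pair_prob_space "root_measure (real p / 2)" "root_measure (real q / 2)" ..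
  have space_eq: "space ?M = circle \<times> circle"
    using sets_eq_imp_space_eq[OF sets_root_measure_pair[OF p q]] by (simp add: space_restrict_space)
  have meas: "f \<in> borel_measurable ?M"
    using borel_measurable_continuous_on_restrict[OF f]
      measurable_cong_sets[OF sets_root_measure_pair[OF p q] refl] by blast
  have "bounded (f ` (circle \<times> circle))"
    using f by (intro compact_imp_bounded compact_continuous_image compact_Times) auto
  then obtain B where "\<And>x. x \<in> circle \<times> circle \<Longrightarrow> norm (f x) \<le> B"
    unfolding bounded_iff by blast
  then have "AE x in ?M. norm (f x) \<le> B"
    by (intro AE_I2) (simp add: space_eq)
  then show int: ?integrable
    using meas by (rule PQ.P.integrable_const_bound)
  have slice: "(\<lambda>w. f (z, w)) \<in> borel_measurable (restrict_space borel circle)" if "z \<in> circle" for z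
    using that
    by (intro borel_measurable_continuous_on_restrict continuous_on_compose2[OF f] continuous_intros) auto
  have "(\<integral>z. f z \<partial>?M) = (\<integral>z. (\<integral>w. f (z, w) \<partial>root_measure (real q / 2)) \<partial>root_measure (real p / 2))"
    by (rule PQ.integral_fst'[OF int, symmetric])
  also have "\<dots> = (\<integral>z. (\<Sum>w | w ^ q = 1. f (z, w)) / of_nat q \<partial>root_measure (real p / 2))"
    using slice sets_eq_imp_space_eq[OF sets_root_measure[OF p]]
    by (intro Bochner_Integration.integral_cong refl integral_root_measure[OF q])
       (simp add: space_restrict_space)
  \<comment> \<open>The roots \<open>w\<close> lie on the circle, so the inner average is continuous
    in \<open>z\<close>, which gives the measurability required here.\<close>
  also have "\<dots> = (\<Sum>z | z ^ p = 1. (\<Sum>w | w ^ q = 1. f (z, w)) / of_nat q) / of_nat p"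
    using roots_of_unity_circle[OF q] q
    by (intro integral_root_measure[OF p] borel_measurable_continuous_on_restrict continuous_intros
        continuous_on_compose2[OF f]) auto
  finally show ?integral
    by (simp add: sum_divide_distrib mult.commute)
qed

text \<open>The inverses are continuous because the circle avoids 0.\<close>

lemma continuous_on_R_poly: "continuous_on (circle \<times> circle) (R_poly m n)"
  unfolding R_poly_def case_prod_unfold by (intro continuous_intros) auto

lemma cnj_eq_inverse:
  assumes "z \<in> circle"
  shows "cnj z = inverse z"
proof -
  have "z * cnj z = 1"
    using assms by (simp add: complex_norm_square[symmetric])
  then show ?thesis
    by (rule inverse_unique[symmetric])
qed

section \<open>The diagonal group given by two roots of unity\<close>

definition diagonal_element :: "complex \<Rightarrow> complex \<Rightarrow> complex mat" where
  "diagonal_element a b = mat_diag 3 (\<lambda>i. [a, inverse b, inverse a * b] ! i)"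

lemma Zpq_eq: "Zpq p q = (\<lambda>(a, b). diagonal_element a b) ` ({a. a ^ p = 1} \<times> {b. b ^ q = 1})"
  by (auto simp: Zpq_def diagonal_element_def)

lemma diagonal_element_index:
  "diagonal_element a b $$ (0, 0) = a" "diagonal_element a b $$ (1, 1) = inverse b"
  "diagonal_element a b $$ (2, 2) = inverse a * b"
  by (simp_all add: diagonal_element_def mat_diag_def)

text \<open>The first two diagonal entries recover the parameters. This turns sums over the group
  into double sums over roots and gives its order.\<close>

lemma diagonal_element_inject: "diagonal_element a b = diagonal_element c d \<longleftrightarrow> a = c \<and> b = d"
  using diagonal_element_index inverse_eq_iff_eq by metis

lemma mat_trace_diagonal_element: "mat_trace (diagonal_element a b) = a + inverse b + inverse a * b"
  by (simp add: mat_trace_def diagonal_element_def mat_diag_def numeral_3_eq_3)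

lemma diagonal_element_mult:
  "diagonal_element a b * diagonal_element c d = diagonal_element (a * c) (b * d)"
  unfolding diagonal_element_def mat_diag_diag
  by (intro eq_matI) (auto simp: mat_diag_def numeral_3_eq_3 less_Suc_eq)

lemma diagonal_element_1: "diagonal_element 1 1 = 1\<^sub>m 3"
  by (intro eq_matI) (auto simp: diagonal_element_def mat_diag_def numeral_3_eq_3 less_Suc_eq)

text \<open>On the circle conjugation is inversion, so the adjoint is the element with inverted
  parameters. The three diagonal entries multiply to 1.\<close>

lemma diagonal_element_in_SU:
  assumes "a \<in> circle" "b \<in> circle"
  shows "diagonal_element a b \<in> carrier (SU 3)"
proof -
  have cnj: "cnj a = inverse a" "cnj b = inverse b" and nz: "a \<noteq> 0" "b \<noteq> 0"
    using assms by (auto simp: cnj_eq_inverse)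
  have adj: "mat_adjoint (diagonal_element a b) = diagonal_element (inverse a) (inverse b)"
    using cnj by (intro eq_matI)
      (auto simp: mat_adjoint_eq diagonal_element_def mat_diag_def numeral_3_eq_3 less_Suc_eq)
  have carr: "diagonal_element a b \<in> carrier_mat 3 3"
    by (simp add: diagonal_element_def)
  have "upper_triangular (diagonal_element a b)"
    by (auto simp: upper_triangular_def diagonal_element_def mat_diag_def)
  then have "Determinant.det (diagonal_element a b) = 1"
    using carr nz
    by (subst det_upper_triangular)
       (auto simp: diag_mat_def diagonal_element_def mat_diag_def numeral_3_eq_3 field_simps)
  then show ?thesis
    using carr nz by (simp add: SU_def adj diagonal_element_mult diagonal_element_1)
qed

lemma subgroup_Zpq:
  assumes p: "p > 0" and q: "q > 0"
  shows "subgroup (Zpq p q) (SU 3)"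
proof -
  interpret group "SU 3" by (rule group_SU)
  have circ: "a \<in> circle" "b \<in> circle" if "a ^ p = 1" "b ^ q = 1" for a b :: complex
    using that roots_of_unity_circle[OF p] roots_of_unity_circle[OF q] by auto
  show ?thesis
  proof (rule subgroupI)
    show "Zpq p q \<subseteq> carrier (SU 3)"
      using circ by (auto simp: Zpq_eq intro: diagonal_element_in_SU)
    show "Zpq p q \<noteq> {}"
      by (auto simp: Zpq_eq intro: exI[of _ 1])
  next
    fix A assume "A \<in> Zpq p q"
    then obtain a b where A: "A = diagonal_element a b" and ab: "a ^ p = 1" "b ^ q = 1"
      by (auto simp: Zpq_eq)
    have nz: "a \<noteq> 0" "b \<noteq> 0"
      using circ[OF ab] by auto
    have ab': "inverse a ^ p = 1" "inverse b ^ q = 1"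
      using ab by (simp_all add: power_inverse)
    have "inv\<^bsub>SU 3\<^esub> A = diagonal_element (inverse a) (inverse b)"
      unfolding A using circ[OF ab] circ[OF ab'] nz
      by (intro inv_equality diagonal_element_in_SU) (auto simp: SU_def diagonal_element_mult diagonal_element_1)
    then show "inv\<^bsub>SU 3\<^esub> A \<in> Zpq p q"
      using ab' by (auto simp: Zpq_eq)
  next
    fix A B assume "A \<in> Zpq p q" "B \<in> Zpq p q"
    then show "A \<otimes>\<^bsub>SU 3\<^esub> B \<in> Zpq p q"
      by (auto simp: Zpq_eq SU_def diagonal_element_mult power_mult_distrib intro!: image_eqI[of _ _ "(_, _)"])
  qed
qed

theorem theorem3p1:
  fixes p q :: nat
  assumes "p \<ge> 1" and "q \<ge> 1"
  shows "spectral_measure (Zpq p q) (root_measure (real p / 2) \<Otimes>\<^sub>M root_measure (real q / 2))"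
proof -
  have p: "p > 0" and q: "q > 0"
    using assms by auto
  let ?U = "\<lambda>n. {z :: complex. z ^ n = 1}"
  have finite: "finite (Zpq p q)"
    unfolding Zpq_eq using p q by (intro finite_imageI finite_cartesian_product finite_roots_unity) auto
  interpret finite_diagonal_subgroup "Zpq p q"
    by (rule finite_diagonal_subgroup.intro[OF subgroup_Zpq[OF p q] finite])
       (auto simp: Zpq_eq diagonal_element_def mat_diag_def diagonal_mat_def)
  have inj: "inj_on (\<lambda>(a, b). diagonal_element a b) (?U p \<times> ?U q)"
    by (auto simp: inj_on_def diagonal_element_inject)
  have card: "card (Zpq p q) = p * q"
    unfolding Zpq_eq card_image[OF inj] using p q by (simp add: card_cartesian_product card_roots_unity_eq)
  have moment: "mckay_moment (Zpq p q) m n =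
      (\<Sum>z\<in>?U p. \<Sum>w\<in>?U q. R_poly m n (z, w)) / of_nat (p * q)" for m n
  proof -
    have "mat_trace (diagonal_element z w) ^ m * cnj (mat_trace (diagonal_element z w)) ^ n = R_poly m n (z, w)"
      if "z \<in> ?U p" "w \<in> ?U q" for z w
    proof -
      \<comment> \<open>Conjugation inverts roots of unity, so the conjugate trace is exactly the
        second factor of \<open>R_poly\<close>.\<close>
      have "cnj z = inverse z" "cnj w = inverse w"
        using that roots_of_unity_circle[OF p] roots_of_unity_circle[OF q]
        by (auto simp: cnj_eq_inverse)
      then show ?thesis
        by (simp add: mat_trace_diagonal_element R_poly_def)
    qed
    then have "(\<Sum>g\<in>Zpq p q. mat_trace g ^ m * cnj (mat_trace g) ^ n) =
        (\<Sum>(z, w)\<in>?U p \<times> ?U q. R_poly m n (z, w))"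
      unfolding Zpq_eq sum.reindex[OF inj] by (intro sum.cong) auto
    then show ?thesis
      by (simp add: mckay_moment_eq card sum.cartesian_product)
  qed
  show ?thesis
    unfolding spectral_measure_def
    using finite subgroup_SU sets_root_measure_pair[OF p q]
      integral_root_measure_pair[OF p q continuous_on_R_poly]
    by (simp add: moment)
qed

end
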